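(* Let $\mathcal{K}\subset\mathbb{R}^d$ be a compact convex set, symmetric about the origin, let $\zeta$ be uniformly distributed on $\mathcal{K}$, let $\mathcal{X}\subset\mathbb{R}^n$ be closed, convex and bounded, and let $T\in\mathbb{R}^{d\times n}$. Let $f(\mathbf{x})=\mathbb{P}\{\zeta: \zeta\in\mathbf{K}(\mathbf{x})\}$ with $\mathbf{K}(\mathbf{x})=\{\zeta\in\mathcal{K}: T\mathbf{x}-\zeta\ge 0\}$ (componentwise inequality), and let $h(\mathbf{x})=-\log(f(\mathbf{x}))$. Then: (a) $h$ is convex on $\mathcal{X}$. (b) $\mathbf{x}^*$ minimizes $h$ over $\mathcal{X}$ if and only if $\mathbf{x}^*$ is a maximizer of $f$ over $\mathcal{X}$.
   Context: Convention: $h(\mathbf{x})=+\infty$ where $f(\mathbf{x})=0$, and convexity is understood for extended-real-valued functions. *)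

theory Defs
  imports "HOL-Probability.Probability"
begin

definition event_set ::
    "(real ^ 'd) set \<Rightarrow> real ^ 'n ^ 'd \<Rightarrow> real ^ 'n \<Rightarrow> (real ^ 'd) set" where
  "event_set K T x = {z \<in> K. \<forall>i. (T *v x - z) $ i \<ge> 0}"

definition success_prob ::
    "'a measure \<Rightarrow> ('a \<Rightarrow> real ^ 'd) \<Rightarrow> (real ^ 'd) set \<Rightarrow> real ^ 'n ^ 'd \<Rightarrow> real ^ 'n \<Rightarrow> real" where
  "success_prob M \<zeta> K T x = \<P>(\<omega> in M. \<zeta> \<omega> \<in> event_set K T x)"

definition neg_log_prob ::
    "'a measure \<Rightarrow> ('a \<Rightarrow> real ^ 'd) \<Rightarrow> (real ^ 'd) set \<Rightarrow> real ^ 'n ^ 'd \<Rightarrow> real ^ 'n \<Rightarrow> ereal" where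
  "neg_log_prob M \<zeta> K T x =
     (if success_prob M \<zeta> K T x = 0 then \<infinity> else ereal (- ln (success_prob M \<zeta> K T x)))"

(* The counterpart of convex_on for functions with values in (-\<infinity>, \<infinity>]. Since 0 * \<infinity> = 0 in
   ereal, the cases u = 0 and v = 0 are trivial. The value -\<infinity> is excluded because the ereal
   convention \<infinity> + (-\<infinity>) = \<infinity> would otherwise enter the right-hand side. *)
definition ereal_convex_on :: "'v::real_vector set \<Rightarrow> ('v \<Rightarrow> ereal) \<Rightarrow> bool" where
  "ereal_convex_on S g \<longleftrightarrow> convex S \<and> (\<forall>x\<in>S. g x \<noteq> -\<infinity>) \<and>
     (\<forall>x\<in>S. \<forall>y\<in>S. \<forall>u\<ge>0. \<forall>v\<ge>0. u + v = 1 \<longrightarrow>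
        g (u *\<^sub>R x + v *\<^sub>R y) \<le> ereal u * g x + ereal v * g y)"

end

theory Submission
  imports Defs
begin

text \<open>
  Since \<open>K\<close> is convex, \<open>u E(x) + v E(y) \<subseteq> E(u x + v y)\<close> for the event sets \<open>E\<close>, so convexity of \<open>h\<close>
  is the multiplicative Brunn--Minkowski inequality \<open>|A|\<^sup>u |B|\<^sup>v \<le> |u A + v B|\<close>. We prove it by the
  method of Hadwiger and Ohmann: for two boxes it is the weighted arithmetic-geometric mean
  inequality; for finite unions of disjoint boxes one cuts \<open>A\<close> by a hyperplane separating two of its
  boxes and \<open>B\<close> by a parallel hyperplane in the same proportion, and adds the inequalities for the
  two halves; open sets are exhausted by such unions.
\<close>

section \<open>The multiplicative Brunn-Minkowski inequality and the case of two boxes\<close>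

text \<open>The set \<open>W\<close> stands in for the Minkowski combination of \<open>A\<close> and
  \<open>B\<close>, which need not be measurable. With this form no sumset ever has to be measured,
  and restricting \<open>A\<close> and \<open>B\<close> to pieces only weakens the condition on
  \<open>W\<close>.\<close>

definition mult_brunn_minkowski :: "real \<Rightarrow> real \<Rightarrow> 'a::euclidean_space set \<Rightarrow> 'a set \<Rightarrow> bool" where
  "mult_brunn_minkowski u v A B \<longleftrightarrow>
     (\<forall>W\<in>lmeasurable. (\<forall>x\<in>A. \<forall>y\<in>B. u *\<^sub>R x + v *\<^sub>R y \<in> W) \<longrightarrow>
        measure lebesgue A powr u * measure lebesgue B powr v \<le> measure lebesgue W)"

lemma mult_brunn_minkowski_commute:
  "mult_brunn_minkowski u v A B \<longleftrightarrow> mult_brunn_minkowski v u B A"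
  unfolding mult_brunn_minkowski_def by (simp add: add.commute mult.commute) blast

lemma measure_box_nonempty:
  fixes a b :: "'a::euclidean_space"
  assumes "box a b \<noteq> {}"
  shows "measure lebesgue (box a b) = (\<Prod>i\<in>Basis. (b - a) \<bullet> i)"
proof -
  have "\<forall>i\<in>Basis. a \<bullet> i \<le> b \<bullet> i"
    using assms by (auto simp: box_ne_empty less_imp_le)
  then show ?thesis
    by (simp add: measure_lborel_box)
qed

text \<open>The combination of two boxes fills the box whose side lengths are the weighted means of
  the given ones, so the claim is a product over coordinates of weighted arithmetic-geometric mean
  inequalities.\<close>

lemma mult_brunn_minkowski_box:
  fixes a b c d :: "'a::euclidean_space"
  assumes ne: "box a b \<noteq> {}" "box c d \<noteq> {}" and uv: "u > 0" "v > 0" "u + v = 1"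
  shows "mult_brunn_minkowski u v (box a b) (box c d)"
  unfolding mult_brunn_minkowski_def
proof (intro ballI impI)
  fix W :: "'a set"
  assume W: "W \<in> lmeasurable" and sub: "\<forall>x\<in>box a b. \<forall>y\<in>box c d. u *\<^sub>R x + v *\<^sub>R y \<in> W"
  have ab: "a \<bullet> i < b \<bullet> i" and cd: "c \<bullet> i < d \<bullet> i" if "i \<in> Basis" for i
    using ne that by (auto simp: box_ne_empty)
  define p q where "p = u *\<^sub>R a + v *\<^sub>R c" and "q = u *\<^sub>R b + v *\<^sub>R d"
  have pq: "(q - p) \<bullet> i = u * ((b - a) \<bullet> i) + v * ((d - c) \<bullet> i)" for i
    by (simp add: p_def q_def algebra_simps)
  have pos: "(q - p) \<bullet> i > 0" if "i \<in> Basis" for i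
    unfolding pq using ab[OF that] cd[OF that] uv by (simp add: inner_diff_left add_pos_pos)
  have pq_ne: "box p q \<noteq> {}"
    using pos by (auto simp: box_ne_empty inner_diff_left)
  have "box p q \<subseteq> W"
  proof
    fix z assume z: "z \<in> box p q"
    \<comment> \<open>The relative position of \<open>z\<close> in each coordinate of
      \<open>box p q\<close>. The points \<open>x\<close> and \<open>y\<close> below take the same
      relative position in their own boxes, so they combine to \<open>z\<close>.\<close>
    define t where "t i = (z - p) \<bullet> i / ((q - p) \<bullet> i)" for i
    have t: "0 < t i" "t i < 1" if "i \<in> Basis" for i
      using z pos[OF that] that by (auto simp: t_def mem_box inner_diff_left)
    define x where "x = (\<Sum>i\<in>Basis. (a \<bullet> i + t i * ((b - a) \<bullet> i)) *\<^sub>R i)"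
    define y where "y = (\<Sum>i\<in>Basis. (c \<bullet> i + t i * ((d - c) \<bullet> i)) *\<^sub>R i)"
    have between: "r < r + s * (r' - r) \<and> r + s * (r' - r) < r'" if "r < r'" "0 < s" "s < 1"
      for r r' s :: real
    proof -
      have "0 < s * (r' - r)" "s * (r' - r) < 1 * (r' - r)"
        using that by (auto intro: mult_pos_pos mult_strict_right_mono)
      then show ?thesis by simp
    qed
    have "x \<in> box a b" "y \<in> box c d"
      using between t ab cd by (simp_all add: mem_box x_def y_def inner_diff_left)
    moreover have "z = u *\<^sub>R x + v *\<^sub>R y"
    proof (rule euclidean_eqI)
      fix i :: 'a assume i: "i \<in> Basis"
      have "(u *\<^sub>R x + v *\<^sub>R y) \<bullet> i = p \<bullet> i + t i * ((q - p) \<bullet> i)"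
        unfolding pq using i by (simp add: x_def y_def p_def inner_add_left) argo
      also have "\<dots> = z \<bullet> i"
        using pos[OF i] by (simp add: t_def inner_diff_left)
      finally show "z \<bullet> i = (u *\<^sub>R x + v *\<^sub>R y) \<bullet> i" by simp
    qed
    ultimately show "z \<in> W" using sub by blast
  qed
  then have "measure lebesgue (box p q) \<le> measure lebesgue W"
    using W by (intro measure_mono_fmeasurable) auto
  moreover have "measure lebesgue (box a b) powr u * measure lebesgue (box c d) powr v
      \<le> measure lebesgue (box p q)"
  proof -
    have "measure lebesgue (box a b) powr u * measure lebesgue (box c d) powr v
        = (\<Prod>i\<in>Basis. ((b - a) \<bullet> i) powr u * ((d - c) \<bullet> i) powr v)"
      unfolding measure_box_nonempty[OF ne(1)] measure_box_nonempty[OF ne(2)]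
      by (simp add: prod_powr_distrib prod.distrib)
    \<comment> \<open>\<open>Youngs_inequality_0\<close> is the weighted arithmetic-geometric mean
      inequality for one coordinate.\<close>
    also have "\<dots> \<le> (\<Prod>i\<in>Basis. (q - p) \<bullet> i)"
      unfolding pq using ab cd uv
      by (intro prod_mono conjI Youngs_inequality_0) (auto simp: inner_diff_left)
    finally show ?thesis by (simp only: measure_box_nonempty[OF pq_ne])
  qed
  ultimately show "measure lebesgue (box a b) powr u * measure lebesgue (box c d) powr v
      \<le> measure lebesgue W" by linarith
qed

section \<open>Cutting sets by coordinate hyperplanes\<close>

lemma open_halfspaces_lebesgue [simp]:
  fixes i :: "'a::euclidean_space"
  shows "{x. x \<bullet> i < s} \<in> sets lebesgue" "{x. s < x \<bullet> i} \<in> sets lebesgue"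
  by (auto intro!: borel_open open_halfspace_component_lt open_halfspace_component_gt
      open_Collect_less continuous_intros)

lemma lmeasurable_Int_halfspaces:
  fixes i :: "'a::euclidean_space"
  assumes "A \<in> lmeasurable"
  shows "A \<inter> {x. x \<bullet> i < s} \<in> lmeasurable" "A \<inter> {x. s < x \<bullet> i} \<in> lmeasurable"
  using assms by (auto intro!: fmeasurable_Int_fmeasurable)

lemma measure_hyperplane_split:
  fixes i :: "'a::euclidean_space"
  assumes A: "A \<in> lmeasurable" and i: "i \<in> Basis"
  shows "measure lebesgue A
    = measure lebesgue (A \<inter> {x. x \<bullet> i < s}) + measure lebesgue (A \<inter> {x. s < x \<bullet> i})"
proof -
  let ?L = "A \<inter> {x. x \<bullet> i < s}" and ?R = "A \<inter> {x. s < x \<bullet> i}"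
  have "measure lebesgue A = measure lebesgue (?L \<union> ?R)"
  proof (rule measure_negligible_symdiff)
    show "?L \<union> ?R \<in> lmeasurable"
      using lmeasurable_Int_halfspaces[OF A] by blast
    have "negligible {x. x \<bullet> i = s}"
      using i by (rule negligible_standard_hyperplane)
    then show "negligible (?L \<union> ?R - A \<union> (A - (?L \<union> ?R)))"
      by (rule negligible_subset) auto
  qed
  also have "\<dots> = measure lebesgue ?L + measure lebesgue ?R"
  proof -
    have "?L \<inter> ?R = {}" by auto
    then show ?thesis
      using lmeasurable_Int_halfspaces[OF A] by (simp add: measure_Un3)
  qed
  finally show ?thesis .
qed

text \<open>Projecting Lebesgue measure on \<open>A\<close> to the \<open>i\<close>-th coordinate
  gives a finite measure on the line. It has no atoms because hyperplanes are null, so its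
  distribution function is continuous and attains \<open>m\<close> by the intermediate value
  theorem.\<close>

lemma halfspace_bisection:
  fixes i :: "'a::euclidean_space"
  assumes A: "A \<in> lmeasurable" and i: "i \<in> Basis" and m: "0 < m" "m < measure lebesgue A"
  obtains s where "measure lebesgue (A \<inter> {x. x \<bullet> i < s}) = m"
proof -
  define D where "D = distr (lebesgue_on A) borel (\<lambda>x. x \<bullet> i)"
  interpret A: finite_measure "lebesgue_on A"
    using A by (rule finite_measure_lebesgue_on)
  have meas [measurable]: "(\<lambda>x. x \<bullet> i) \<in> borel_measurable (lebesgue_on A)"
    by (intro measurable_restrict_space1 measurable_completion) auto
  interpret D: finite_borel_measure D
    by (intro finite_borel_measure.intro finite_borel_measure_axioms.intro)
       (auto simp: D_def intro: A.finite_measure_distr)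
  have D: "measure D S = measure lebesgue (A \<inter> {x. x \<bullet> i \<in> S})" if "S \<in> sets borel" for S
  proof -
    have "measure D S = measure (lebesgue_on A) ((\<lambda>x. x \<bullet> i) -` S \<inter> A)"
      using that by (simp add: D_def measure_distr space_restrict_space)
    also have "\<dots> = measure lebesgue ((\<lambda>x. x \<bullet> i) -` S \<inter> A)"
      using A by (intro measure_restrict_space) auto
    also have "(\<lambda>x. x \<bullet> i) -` S \<inter> A = A \<inter> {x. x \<bullet> i \<in> S}" by auto
    finally show ?thesis .
  qed
  have null: "measure D {t} = 0" for t
  proof -
    have "negligible {x. x \<bullet> i = t}"
      using i by (rule negligible_standard_hyperplane)
    then have "negligible (A \<inter> {x. x \<bullet> i \<in> {t}})"
      by (rule negligible_subset) auto
    then show ?thesis by (simp add: D negligible_imp_measure0)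
  qed
  have cont: "isCont (cdf D) t" for t
    using D.isCont_cdf null by blast
  have total: "measure D (space D) = measure lebesgue A"
    using D[of UNIV] by (simp add: D.borel_UNIV)
  have "\<forall>\<^sub>F t in at_bot. cdf D t < m"
    using D.cdf_lim_at_bot m(1) by (rule order_tendstoD)
  then obtain lo where lo: "cdf D t < m" if "t \<le> lo" for t
    by (auto simp: eventually_at_bot_linorder)
  have "\<forall>\<^sub>F t in at_top. m < cdf D t"
    using D.cdf_lim_at_top m(2) unfolding total by (rule order_tendstoD)
  then obtain hi where hi: "m < cdf D t" if "t \<ge> hi" for t
    by (auto simp: eventually_at_top_linorder)
  \<comment> \<open>Nothing orders \<open>lo\<close> and \<open>hi\<close>, so
    \<open>max lo hi\<close> serves as the right end of the interval.\<close>
  have "\<exists>s\<ge>lo. s \<le> max lo hi \<and> cdf D s = m"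
    using lo[of lo] hi[of "max lo hi"] cont by (intro IVT) auto
  then obtain s where s: "cdf D s = m" by blast
  \<comment> \<open>The distribution function counts the closed half-line, the claim the open one;
    the endpoint has no mass.\<close>
  have "measure D {..s} = measure D {..<s} + measure D {s}"
    unfolding ivl_disj_un(2)[symmetric] by (rule D.finite_measure_Union) auto
  then have "measure D {..<s} = m"
    using s null by (simp add: cdf_def)
  then show thesis
    using that[of s] D[of "{..<s}"] by simp
qed

text \<open>Combinations of the lower pieces lie below the level \<open>u * s + v * t\<close>, those
  of the upper pieces above it, so the two inequalities bound disjoint parts of \<open>W\<close>.
  Since \<open>u + v = 1\<close>, the left-hand side is homogeneous of degree one: the equal
  proportions come out as the factors \<open>l\<close> and \<open>1 - l\<close>, which add up to
  one.\<close>

lemma mult_brunn_minkowski_glue: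
  fixes i :: "'a::euclidean_space"
  assumes i: "i \<in> Basis" and uv: "u > 0" "v > 0" "u + v = 1"
    and A: "A \<in> lmeasurable" and B: "B \<in> lmeasurable" and l: "0 \<le> l" "l \<le> 1"
    and lA: "measure lebesgue (A \<inter> {x. x \<bullet> i < s}) = l * measure lebesgue A"
    and lB: "measure lebesgue (B \<inter> {x. x \<bullet> i < t}) = l * measure lebesgue B"
    and lower: "mult_brunn_minkowski u v (A \<inter> {x. x \<bullet> i < s}) (B \<inter> {x. x \<bullet> i < t})"
    and upper: "mult_brunn_minkowski u v (A \<inter> {x. s < x \<bullet> i}) (B \<inter> {x. t < x \<bullet> i})"
  shows "mult_brunn_minkowski u v A B"
  unfolding mult_brunn_minkowski_def
proof (intro ballI impI)
  fix W :: "'a set"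
  assume W: "W \<in> lmeasurable" and sub: "\<forall>x\<in>A. \<forall>y\<in>B. u *\<^sub>R x + v *\<^sub>R y \<in> W"
  define r where "r = u * s + v * t"
  let ?m = "measure lebesgue"
  let ?P = "?m A powr u * ?m B powr v"
  have homog: "(k * ?m A) powr u * (k * ?m B) powr v = k * ?P" if "k \<ge> 0" for k
  proof -
    have "k powr u * k powr v = k"
      using that uv by (cases "k = 0") (auto simp flip: powr_add)
    then show ?thesis
      using that by (simp add: powr_mult mult_ac)
  qed
  have uA: "?m (A \<inter> {x. s < x \<bullet> i}) = (1 - l) * ?m A"
    using measure_hyperplane_split[OF A i, of s] lA by (simp add: algebra_simps)
  have uB: "?m (B \<inter> {x. t < x \<bullet> i}) = (1 - l) * ?m B"
    using measure_hyperplane_split[OF B i, of t] lB by (simp add: algebra_simps)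
  have "u *\<^sub>R x + v *\<^sub>R y \<in> W \<inter> {x. x \<bullet> i < r}"
    if "x \<in> A \<inter> {x. x \<bullet> i < s}" "y \<in> B \<inter> {x. x \<bullet> i < t}" for x y
    using that sub uv by (auto simp: r_def inner_add_left intro!: add_strict_mono)
  then have "l * ?P \<le> ?m (W \<inter> {x. x \<bullet> i < r})"
    using lower lmeasurable_Int_halfspaces(1)[OF W] homog[OF l(1)]
    unfolding mult_brunn_minkowski_def lA lB by fastforce
  moreover have "u *\<^sub>R x + v *\<^sub>R y \<in> W \<inter> {x. r < x \<bullet> i}"
    if "x \<in> A \<inter> {x. s < x \<bullet> i}" "y \<in> B \<inter> {x. t < x \<bullet> i}" for x y
    using that sub uv by (auto simp: r_def inner_add_left intro!: add_strict_mono)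
  then have "(1 - l) * ?P \<le> ?m (W \<inter> {x. r < x \<bullet> i})"
    using upper lmeasurable_Int_halfspaces(2)[OF W] homog[of "1 - l"] l
    unfolding mult_brunn_minkowski_def uA uB by fastforce
  ultimately show "?P \<le> ?m W"
    using measure_hyperplane_split[OF W i, of r] by (simp add: algebra_simps)
qed

section \<open>Finite families of disjoint boxes and their slices\<close>

definition box_family :: "'a::euclidean_space set set \<Rightarrow> bool" where
  "box_family F \<longleftrightarrow> finite F \<and> pairwise disjnt F \<and> (\<forall>P\<in>F. P \<noteq> {} \<and> (\<exists>a b. P = box a b))"

lemma box_family_lmeasurable: "box_family F \<Longrightarrow> \<Union>F \<in> lmeasurable"
  by (intro fmeasurable.finite_Union) (auto simp: box_family_def)

lemma box_family_measure_pos: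
  assumes "box_family F" "F \<noteq> {}"
  shows "measure lebesgue (\<Union>F) > 0"
proof -
  obtain P a b where P: "P \<in> F" "P = box a b" "P \<noteq> {}"
    using assms unfolding box_family_def by blast
  have "0 < measure lebesgue P"
    unfolding P(2) measure_box_nonempty[OF P(3)[unfolded P(2)]]
    using P by (intro prod_pos) (auto simp: box_ne_empty inner_diff_left)
  also have "\<dots> \<le> measure lebesgue (\<Union>F)"
    using P box_family_lmeasurable[OF assms(1)] by (intro measure_mono_fmeasurable) auto
  finally show ?thesis .
qed

text \<open>Empty pieces are dropped so that slices of a box family are box families again and the
  number of members can serve as induction measure.\<close>

definition slice :: "'a set set \<Rightarrow> 'a set \<Rightarrow> 'a set set" where
  "slice F H = (\<lambda>P. P \<inter> H) ` F - {{}}"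

lemma Union_slice: "\<Union>(slice F H) = \<Union>F \<inter> H"
  by (auto simp: slice_def)

lemma card_slice_le: "finite F \<Longrightarrow> card (slice F H) \<le> card F"
  unfolding slice_def by (meson card_Diff1_le card_image_le finite_imageI order_trans)

lemma card_slice_less:
  assumes "finite F" "P \<in> F" "P \<inter> H = {}"
  shows "card (slice F H) < card F"
proof -
  have "slice F H \<subseteq> (\<lambda>Q. Q \<inter> H) ` (F - {P})"
    using assms by (auto simp: slice_def)
  then have "card (slice F H) \<le> card (F - {P})"
    using assms by (meson card_image_le card_mono finite_Diff finite_imageI order_trans)
  also have "\<dots> < card F"
    using assms by (meson card_Diff1_less)
  finally show ?thesis .
qed

lemma box_Int_halfspaces:
  fixes a b i :: "'a::euclidean_space"
  assumes "i \<in> Basis"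
  shows "\<exists>c d. box a b \<inter> {x. x \<bullet> i < s} = box c d" "\<exists>c d. box a b \<inter> {x. s < x \<bullet> i} = box c d"
proof -
  have shift: "(c + k *\<^sub>R i) \<bullet> j = c \<bullet> j + (if j = i then k else 0)" if "j \<in> Basis" for c j :: 'a and k
    using that assms by (simp add: inner_add_left inner_Basis)
  \<comment> \<open>Only the \<open>i\<close>-th coordinate of one corner moves to the cut. If the
    cut leaves nothing of the box, the formula yields an empty \<open>box\<close>.\<close>
  have "box a b \<inter> {x. x \<bullet> i < s} = box a (b + (min (b \<bullet> i) s - b \<bullet> i) *\<^sub>R i)"
    using assms by (auto simp: mem_box shift split: if_splits)
  then show "\<exists>c d. box a b \<inter> {x. x \<bullet> i < s} = box c d" by blast
  have "box a b \<inter> {x. s < x \<bullet> i} = box (a + (max (a \<bullet> i) s - a \<bullet> i) *\<^sub>R i) b"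
    using assms by (auto simp: mem_box shift split: if_splits)
  then show "\<exists>c d. box a b \<inter> {x. s < x \<bullet> i} = box c d" by blast
qed

lemma box_family_slice:
  fixes i :: "'a::euclidean_space"
  assumes F: "box_family F" and i: "i \<in> Basis"
    and H: "H = {x. x \<bullet> i < s} \<or> H = {x. s < x \<bullet> i}"
  shows "box_family (slice F H)"
proof -
  have box: "\<exists>c d. box a b \<inter> H = box c d" for a b
    using H box_Int_halfspaces[OF i] by auto
  show ?thesis
    unfolding box_family_def
  proof (intro conjI ballI)
    show "finite (slice F H)"
      using F by (simp add: box_family_def slice_def)
    show "pairwise disjnt (slice F H)"
      using F unfolding box_family_def slice_def pairwise_def disjnt_def by blast
    fix R assume R: "R \<in> slice F H"
    then show "R \<noteq> {}" by (simp add: slice_def)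
    obtain P where P: "P \<in> F" "R = P \<inter> H"
      using R by (auto simp: slice_def)
    obtain a b where "P = box a b"
      using F P(1) unfolding box_family_def by blast
    then show "\<exists>c d. R = box c d"
      using box P(2) by blast
  qed
qed

text \<open>Disjoint boxes have disjoint projections to some coordinate axis; the cut is placed at
  the upper end of the lower projection.\<close>

lemma disjoint_boxes_separated:
  fixes P Q :: "'a::euclidean_space set"
  assumes "P = box a b" "Q = box c d" "P \<noteq> {}" "Q \<noteq> {}" "P \<inter> Q = {}"
  obtains i s where "i \<in> Basis"
    "P \<inter> {x. x \<bullet> i < s} = {} \<and> Q \<inter> {x. s < x \<bullet> i} = {} \<or>
     Q \<inter> {x. x \<bullet> i < s} = {} \<and> P \<inter> {x. s < x \<bullet> i} = {}"
proof -
  have "\<exists>i\<in>Basis. b \<bullet> i \<le> a \<bullet> i \<or> d \<bullet> i \<le> c \<bullet> i \<or> b \<bullet> i \<le> c \<bullet> i \<or> d \<bullet> i \<le> a \<bullet> i"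
    using assms by (simp add: disjoint_interval)
  moreover have "a \<bullet> i < b \<bullet> i" "c \<bullet> i < d \<bullet> i" if "i \<in> Basis" for i
    using assms that by (auto simp: box_ne_empty)
  ultimately obtain i where i: "i \<in> Basis" "b \<bullet> i \<le> c \<bullet> i \<or> d \<bullet> i \<le> a \<bullet> i"
    by (metis not_less)
  from i(2) show thesis
  proof
    assume "b \<bullet> i \<le> c \<bullet> i"
    then show thesis
      using that[OF i(1), of "b \<bullet> i"] i(1) assms(1,2) by (force simp: mem_box)
  next
    assume "d \<bullet> i \<le> a \<bullet> i"
    then show thesis
      using that[OF i(1), of "d \<bullet> i"] i(1) assms(1,2) by (force simp: mem_box)
  qed
qed

section \<open>The Hadwiger-Ohmann induction on the number of boxes\<close>

text \<open>A hyperplane separating two boxes of \<open>F\<close> leaves each side with fewer boxes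
  than \<open>F\<close>, while the parallel cut of \<open>G\<close> never increases the number of
  its boxes. The total count therefore drops on both sides, and the two halves are glued.\<close>

lemma mult_brunn_minkowski_box_family_step:
  fixes F G :: "'a::euclidean_space set set"
  assumes F: "box_family F" and G: "box_family G" "G \<noteq> {}"
    and uv: "u > 0" "v > 0" "u + v = 1" and two: "card F \<ge> 2"
    and IH: "\<And>F' G' :: 'a set set. \<lbrakk>card F' + card G' < card F + card G; box_family F'; F' \<noteq> {}; box_family G'; G' \<noteq> {}\<rbrakk>
      \<Longrightarrow> mult_brunn_minkowski u v (\<Union>F') (\<Union>G')"
  shows "mult_brunn_minkowski u v (\<Union>F) (\<Union>G)"
proof -
  let ?m = "measure lebesgue"
  have fin: "finite F" "finite G" and disj: "pairwise disjnt F"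
    using F G by (auto simp: box_family_def)
  obtain P Q where PQ: "P \<in> F" "Q \<in> F" "P \<noteq> Q"
    using two by (metis card_le_Suc0_iff_eq fin(1) not_less_eq_eq numeral_2_eq_2)
  obtain a b where "P = box a b" "P \<noteq> {}"
    using F PQ(1) unfolding box_family_def by blast
  moreover obtain c d where "Q = box c d" "Q \<noteq> {}"
    using F PQ(2) unfolding box_family_def by blast
  moreover have "P \<inter> Q = {}"
    using disj PQ by (auto simp: pairwise_def disjnt_def)
  ultimately obtain i s where i: "i \<in> Basis"
    and sep: "P \<inter> {x. x \<bullet> i < s} = {} \<and> Q \<inter> {x. s < x \<bullet> i} = {} \<or>
      Q \<inter> {x. x \<bullet> i < s} = {} \<and> P \<inter> {x. s < x \<bullet> i} = {}"
    using disjoint_boxes_separated by metis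
  define L U where "L = {x. x \<bullet> i < s}" and "U = {x. s < x \<bullet> i}"
  \<comment> \<open>An open nonempty box cannot lie inside the cutting hyperplane. Together with
    \<open>sep\<close> this puts a part of \<open>P\<close> on one side and a part of
    \<open>Q\<close> on the other, so neither slice of \<open>F\<close> is empty.\<close>
  have null: "R \<inter> {x. x \<bullet> i < s} \<noteq> {} \<or> R \<inter> {x. s < x \<bullet> i} \<noteq> {}" if "R \<in> F" for R
  proof (rule ccontr)
    assume "\<not> ?thesis"
    then have "R \<subseteq> {x. x \<bullet> i = s}" by force
    then have "negligible R"
      using negligible_standard_hyperplane[OF i] negligible_subset by metis
    moreover have "open R" "R \<noteq> {}" using F that by (auto simp: box_family_def)
    ultimately show False using open_not_negligible by blast
  qed
  have cards: "card (slice F L) < card F" "card (slice F U) < card F"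
    using sep PQ fin unfolding L_def U_def by (auto intro: card_slice_less)
  have bfF: "box_family (slice F L)" "box_family (slice F U)"
    unfolding L_def U_def using box_family_slice[OF F i] by blast+
  have neF: "slice F L \<noteq> {}" "slice F U \<noteq> {}"
    using sep PQ null[of P] null[of Q] unfolding slice_def L_def U_def by blast+
  have FA: "\<Union>F \<in> lmeasurable" "\<Union>G \<in> lmeasurable"
    using F G by (simp_all add: box_family_lmeasurable)
  have posF: "?m (\<Union>F \<inter> L) > 0" "?m (\<Union>F \<inter> U) > 0"
    using box_family_measure_pos bfF neF unfolding Union_slice[symmetric] by blast+
  have posG: "?m (\<Union>G) > 0"
    using G by (rule box_family_measure_pos)
  have split: "?m (\<Union>F) = ?m (\<Union>F \<inter> L) + ?m (\<Union>F \<inter> U)"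
    unfolding L_def U_def by (rule measure_hyperplane_split[OF FA(1) i])
  define l where "l = ?m (\<Union>F \<inter> L) / ?m (\<Union>F)"
  have l: "0 < l" "l < 1" and lF: "?m (\<Union>F \<inter> L) = l * ?m (\<Union>F)"
    using posF split by (auto simp: l_def field_simps)
  \<comment> \<open>The cut of \<open>G\<close> is chosen to match the proportion \<open>l\<close>
    in which \<open>F\<close> was cut. As \<open>l\<close> lies strictly between 0 and 1, both
    halves of \<open>G\<close> have positive measure and hence contain boxes.\<close>
  obtain t where t: "?m (\<Union>G \<inter> {x. x \<bullet> i < t}) = l * ?m (\<Union>G)"
    using halfspace_bisection[OF FA(2) i, of "l * ?m (\<Union>G)"] l posG by auto
  define L' U' where "L' = {x. x \<bullet> i < t}" and "U' = {x. t < x \<bullet> i}"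
  have "?m (\<Union>G \<inter> U') = (1 - l) * ?m (\<Union>G)"
    using measure_hyperplane_split[OF FA(2) i, of t] t by (simp add: U'_def algebra_simps)
  then have "?m (\<Union>(slice G L')) > 0" "?m (\<Union>(slice G U')) > 0"
    using t l posG by (simp_all add: Union_slice L'_def)
  then have neG: "slice G L' \<noteq> {}" "slice G U' \<noteq> {}" by auto
  have bfG: "box_family (slice G L')" "box_family (slice G U')"
    unfolding L'_def U'_def using box_family_slice[OF G(1) i] by blast+
  have "card (slice F L) + card (slice G L') < card F + card G"
    "card (slice F U) + card (slice G U') < card F + card G"
    using cards card_slice_le[OF fin(2)] by (simp_all add: add_less_le_mono)
  note halves = IH[OF this(1) bfF(1) neF(1) bfG(1) neG(1)] IH[OF this(2) bfF(2) neF(2) bfG(2) neG(2)]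
  show ?thesis
    by (rule mult_brunn_minkowski_glue[OF i uv FA less_imp_le[OF l(1)] less_imp_le[OF l(2)]
          lF[unfolded L_def] t halves[unfolded Union_slice L_def U_def L'_def U'_def]])
qed

lemma mult_brunn_minkowski_box_family:
  fixes F G :: "'a::euclidean_space set set"
  assumes "box_family F" "F \<noteq> {}" "box_family G" "G \<noteq> {}" and "u > 0" "v > 0" "u + v = 1"
  shows "mult_brunn_minkowski u v (\<Union>F) (\<Union>G)"
  using assms
\<comment> \<open>The weights are generalized because the case where \<open>G\<close> has several
  boxes is reduced to the other one by exchanging \<open>F\<close> with \<open>G\<close> and
  \<open>u\<close> with \<open>v\<close>.\<close>
proof (induction "card F + card G" arbitrary: F G u v rule: less_induct)
  case less
  have fin: "finite F" "finite G"
    using less.prems by (auto simp: box_family_def)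
  have "card F > 0" "card G > 0"
    using less.prems fin by (simp_all add: card_gt_0_iff)
  then consider "card F \<ge> 2" | "card G \<ge> 2" | "card F = 1" "card G = 1"
    by linarith
  then show ?case
  proof cases
    case 1
    show ?thesis
      by (rule mult_brunn_minkowski_box_family_step[OF less.prems(1,3-7) 1])
        (rule less.hyps, use less.prems in simp_all)
  next
    case 2
    have "mult_brunn_minkowski v u (\<Union>G) (\<Union>F)"
    proof (rule mult_brunn_minkowski_box_family_step[OF less.prems(3,1,2,6,5) _ 2])
      show "v + u = 1" using less.prems by simp
      show "mult_brunn_minkowski v u (\<Union>F') (\<Union>G')"
        if "card F' + card G' < card G + card F" "box_family F'" "F' \<noteq> {}" "box_family G'" "G' \<noteq> {}"
        for F' G' :: "'a set set"
        by (rule less.hyps) (use that less.prems in simp_all)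
    qed
    then show ?thesis by (simp add: mult_brunn_minkowski_commute)
  next
    case 3
    then obtain P Q where PQ: "F = {P}" "G = {Q}" by (auto simp: card_1_singleton_iff)
    obtain a b where "P = box a b" "P \<noteq> {}"
      using less.prems(1) unfolding box_family_def PQ by blast
    moreover obtain c d where "Q = box c d" "Q \<noteq> {}"
      using less.prems(3) unfolding box_family_def PQ by blast
    ultimately show ?thesis
      unfolding PQ using mult_brunn_minkowski_box[of a b c d] less.prems by simp
  qed
qed

section \<open>Passage from boxes to open and to convex sets\<close>

text \<open>A countable cover of \<open>U\<close> by closed boxes in \<open>U\<close> with disjoint
  interiors has finite subfamilies that nearly exhaust the measure. Passing to interiors makes the
  boxes disjoint and open at the cost of their null frontiers.\<close>

lemma open_inner_box_family:
  fixes U :: "'a::euclidean_space set"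
  assumes U: "open U" "bounded U" and e: "e > 0"
  obtains F where "box_family F" "\<Union>F \<subseteq> U" "measure lebesgue U - e < measure lebesgue (\<Union>F)"
proof -
  obtain a b where ab: "U \<subseteq> cbox a b" "box a b \<noteq> {}"
  proof -
    obtain c where c: "U \<subseteq> box (- c) c"
      using bounded_subset_box_symmetric[OF U(2)] by blast
    show thesis
    proof (cases "U = {}")
      case True
      \<comment> \<open>\<open>covering_lemma\<close> asks for a surrounding box with nonempty
        interior, even around the empty set; the unit box will do.\<close>
      then show thesis using that[of 0 One] by (auto simp: box_ne_empty)
    next
      case False
      then show thesis using c that[of "- c" c] box_subset_cbox by blast
    qed
  qed
  \<comment> \<open>Each covering box lies in the gauge set of one of its points in
    \<open>U\<close>; taking that set to be \<open>U\<close> keeps the boxes inside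
    \<open>U\<close>.\<close>
  have "gauge (\<lambda>x. if x \<in> U then U else UNIV)"
    using U by (auto simp: gauge_def)
  from covering_lemma[OF ab this] obtain D where D: "countable D"
    "\<And>K. K \<in> D \<Longrightarrow> interior K \<noteq> {} \<and> (\<exists>c d. K = cbox c d)"
    "pairwise (\<lambda>A B. interior A \<inter> interior B = {}) D"
    "\<And>K. K \<in> D \<Longrightarrow> \<exists>x \<in> U \<inter> K. K \<subseteq> (if x \<in> U then U else UNIV)"
    "U \<subseteq> \<Union>D"
    by metis
  have DU: "K \<subseteq> U" if "K \<in> D" for K using D(4)[OF that] by auto
  then have UD: "\<Union>D = U" using D(5) by blast
  have lm: "K \<in> lmeasurable" if "K \<in> D" for K using D(2)[OF that] by auto
  have Ulm: "U \<in> lmeasurable" using U by (simp add: lmeasurable_open)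
  obtain E where E: "E \<subseteq> D" "finite E" "measure lebesgue (\<Union>D) - e < measure lebesgue (\<Union>E)"
  proof (rule measure_countable_Union_approachable[OF D(1) e lm])
    show "measure lebesgue (\<Union>D') \<le> measure lebesgue U" if "D' \<subseteq> D" "finite D'" for D'
      using that DU lm Ulm
      by (intro measure_mono_fmeasurable) (auto intro!: fmeasurableD fmeasurable.finite_Union)
  qed
  define F where "F = interior ` E"
  have "box_family F"
    unfolding box_family_def
  proof (intro conjI ballI)
    show "finite F" using E by (simp add: F_def)
    show "pairwise disjnt F"
      unfolding F_def
    proof (rule pairwise_imageI)
      fix A B assume "A \<in> E" "B \<in> E" "A \<noteq> B"
      then show "disjnt (interior A) (interior B)"
        using E(1) D(3) unfolding pairwise_def disjnt_def by blast
    qed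
    fix P assume "P \<in> F"
    then obtain K where K: "K \<in> D" "P = interior K" using E by (auto simp: F_def)
    then show "P \<noteq> {}" "\<exists>a b. P = box a b"
      using D(2)[OF K(1)] interior_cbox by blast+
  qed
  moreover have "\<Union>F \<subseteq> U"
    using E(1) DU interior_subset unfolding F_def by blast
  moreover have "measure lebesgue (\<Union>F) = measure lebesgue (\<Union>E)"
  proof (rule measure_negligible_symdiff)
    show "\<Union>E \<in> lmeasurable"
      using E lm by (intro fmeasurable.finite_Union) auto
    have "negligible (\<Union>(frontier ` E))"
      using E D(2) negligible_convex_frontier[OF convex_box(1)]
      by (intro negligible_Union) (fastforce+)
    moreover have "\<Union>E - \<Union>F \<union> (\<Union>F - \<Union>E) \<subseteq> \<Union>(frontier ` E)"
      using interior_subset closure_subset unfolding F_def frontier_def by fastforce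
    ultimately show "negligible (\<Union>E - \<Union>F \<union> (\<Union>F - \<Union>E))"
      by (rule negligible_subset)
  qed
  ultimately show thesis
    using that E(3) UD by simp
qed

lemma mult_brunn_minkowski_open:
  fixes A B :: "'a::euclidean_space set"
  assumes A: "open A" "bounded A" and B: "open B" "bounded B"
    and uv: "u > 0" "v > 0" "u + v = 1"
  shows "mult_brunn_minkowski u v A B"
  unfolding mult_brunn_minkowski_def
proof (intro ballI impI)
  fix W :: "'a set"
  assume W: "W \<in> lmeasurable" and sub: "\<forall>x\<in>A. \<forall>y\<in>B. u *\<^sub>R x + v *\<^sub>R y \<in> W"
  let ?m = "measure lebesgue"
  show "?m A powr u * ?m B powr v \<le> ?m W"
  proof (cases "?m A = 0 \<or> ?m B = 0")
    \<comment> \<open>The left-hand side vanishes because \<open>0 powr u\<close> is 0. Otherwise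
      the inner families below are nonempty for small \<open>e\<close>, and \<open>e\<close> tends
      to 0 from the right.\<close>
    case True
    then show ?thesis using uv by auto
  next
    case False
    then have pos: "?m A > 0" "?m B > 0" by (simp_all add: zero_less_measure_iff)
    have approx: "(?m A - e) powr u * (?m B - e) powr v \<le> ?m W"
      if e: "0 < e" "e < ?m A" "e < ?m B" for e
    proof -
      obtain F where F: "box_family F" "\<Union>F \<subseteq> A" "?m A - e < ?m (\<Union>F)"
        using open_inner_box_family[OF A e(1)] by blast
      obtain G where G: "box_family G" "\<Union>G \<subseteq> B" "?m B - e < ?m (\<Union>G)"
        using open_inner_box_family[OF B e(1)] by blast
      have "F \<noteq> {}" "G \<noteq> {}" using F G e by auto
      then have "mult_brunn_minkowski u v (\<Union>F) (\<Union>G)"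
        using mult_brunn_minkowski_box_family F G uv by blast
      then have "?m (\<Union>F) powr u * ?m (\<Union>G) powr v \<le> ?m W"
        using W sub F(2) G(2) unfolding mult_brunn_minkowski_def by blast
      moreover have "(?m A - e) powr u * (?m B - e) powr v \<le> ?m (\<Union>F) powr u * ?m (\<Union>G) powr v"
        using F G e uv by (intro mult_mono powr_mono2) auto
      ultimately show ?thesis by linarith
    qed
    show ?thesis
    proof (rule tendsto_upperbound)
      show "((\<lambda>e. (?m A - e) powr u * (?m B - e) powr v) \<longlongrightarrow> ?m A powr u * ?m B powr v) (at_right 0)"
        using pos by (auto intro!: tendsto_eq_intros)
      have "\<forall>\<^sub>F e in at_right 0. e \<in> {0<..<min (?m A) (?m B)}"
        using pos by (intro eventually_at_right_real) auto
      then show "\<forall>\<^sub>F e in at_right 0. (?m A - e) powr u * (?m B - e) powr v \<le> ?m W"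
        by (rule eventually_mono) (auto intro: approx)
    qed simp
  qed
qed

text \<open>The frontier of a convex set is null, so replacing both sets by their interiors changes
  no measure and reduces the claim to open sets.\<close>

lemma mult_brunn_minkowski_convex:
  fixes A B :: "'a::euclidean_space set"
  assumes A: "convex A" "bounded A" and B: "convex B" "bounded B"
    and uv: "u > 0" "v > 0" "u + v = 1"
  shows "mult_brunn_minkowski u v A B"
proof -
  have "mult_brunn_minkowski u v (interior A) (interior B)"
    using assms by (intro mult_brunn_minkowski_open) (auto intro: bounded_interior)
  moreover have "measure lebesgue (interior S) = measure lebesgue S" if "convex S" "bounded S" for S :: "'a set"
    using that by (intro measure_interior negligible_convex_frontier)
  ultimately show ?thesis
    using A B interior_subset[of A] interior_subset[of B]
    by (simp add: mult_brunn_minkowski_def subset_iff)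
qed

section \<open>Event sets and log-concavity of the success probability\<close>

text \<open>Linearity of \<open>T\<close> and convexity of \<open>K\<close>. This lets the event set
  at the combined point play the role of \<open>W\<close>.\<close>

lemma event_set_combination:
  assumes "convex K" "a \<in> event_set K T x" "b \<in> event_set K T y" "0 \<le> u" "0 \<le> v" "u + v = 1"
  shows "u *\<^sub>R a + v *\<^sub>R b \<in> event_set K T (u *\<^sub>R x + v *\<^sub>R y)"
proof -
  have "u *\<^sub>R a + v *\<^sub>R b \<in> K"
    using assms by (auto simp: event_set_def convex_def)
  moreover have "u * a $ i + v * b $ i \<le> u * (T *v x) $ i + v * (T *v y) $ i" for i
    using assms by (intro add_mono mult_left_mono) (auto simp: event_set_def)
  ultimately show ?thesis
    by (simp add: event_set_def matrix_vector_right_distrib matrix_vector_mult_scaleR)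
qed

lemma convex_event_set:
  fixes K :: "(real ^ 'd) set"
  shows "convex K \<Longrightarrow> convex (event_set K T x)"
proof (rule convexI)
  fix a b :: "real ^ 'd" and u v :: real
  assume "convex K" "a \<in> event_set K T x" "b \<in> event_set K T x" "0 \<le> u" "0 \<le> v" "u + v = 1"
  then show "u *\<^sub>R a + v *\<^sub>R b \<in> event_set K T x"
    using event_set_combination[of K a T x b x u v] by (simp flip: scaleR_add_left)
qed

lemma compact_event_set: "compact K \<Longrightarrow> compact (event_set K T x)"
proof -
  assume "compact K"
  moreover have "closed {z. \<forall>i. (T *v x - z) $ i \<ge> 0}"
    by (intro closed_Collect_all closed_Collect_le continuous_intros)
  ultimately have "compact (K \<inter> {z. \<forall>i. (T *v x - z) $ i \<ge> 0})"
    by (rule compact_Int_closed)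
  then show ?thesis by (simp add: event_set_def Collect_conj_eq)
qed

lemma success_prob_eq:
  fixes \<zeta> :: "'a \<Rightarrow> real ^ 'd"
  assumes K: "compact K" and M: "prob_space M" and \<zeta>: "\<zeta> \<in> borel_measurable M"
    and unif: "distr M lborel \<zeta> = uniform_measure lborel K"
  shows "measure lborel K > 0"
    and "success_prob M \<zeta> K T x = measure lebesgue (event_set K T x) / measure lborel K"
proof -
  interpret prob_space M by fact
  have E: "event_set K T x \<in> sets borel" and Kb: "K \<in> sets borel"
    using K compact_event_set[OF K] by (auto intro: borel_compact)
  have fin: "emeasure lborel K < \<infinity>"
    using K by (intro emeasure_bounded_finite compact_imp_bounded)
  have "prob_space (distr M lborel \<zeta>)"
    using \<zeta> by (intro prob_space_distr) simp
  then have "emeasure (uniform_measure lborel K) UNIV = 1"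
    unfolding unif using prob_space.emeasure_space_1 by fastforce
  \<comment> \<open>If \<open>K\<close> were null, the uniform measure on it would be the zero
    measure, as \<open>0 / 0 = 0\<close> for extended nonnegative reals, and not a probability
    distribution.\<close>
  then have K0: "emeasure lborel K \<noteq> 0"
    using Kb by (auto simp: emeasure_uniform_measure)
  then show "measure lborel K > 0"
    using fin by (simp add: measure_def enn2real_positive_iff zero_less_iff_neq_zero)
  have "success_prob M \<zeta> K T x = measure (distr M lborel \<zeta>) (event_set K T x)"
    unfolding success_prob_def using \<zeta> E
    by (subst measure_distr) (auto intro!: arg_cong[where f = "measure M"])
  also have "\<dots> = measure lborel (K \<inter> event_set K T x) / measure lborel K"
    unfolding unif using K0 fin E by (intro measure_uniform_measure) auto
  also have "K \<inter> event_set K T x = event_set K T x"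
    by (auto simp: event_set_def)
  finally show "success_prob M \<zeta> K T x = measure lebesgue (event_set K T x) / measure lborel K"
    using E by simp
qed

lemma success_prob_log_concave:
  fixes \<zeta> :: "'a \<Rightarrow> real ^ 'd"
  assumes K: "compact K" "convex K" and M: "prob_space M" "\<zeta> \<in> borel_measurable M"
    and unif: "distr M lborel \<zeta> = uniform_measure lborel K"
    and uv: "u > 0" "v > 0" "u + v = 1"
  shows "success_prob M \<zeta> K T x powr u * success_prob M \<zeta> K T y powr v
    \<le> success_prob M \<zeta> K T (u *\<^sub>R x + v *\<^sub>R y)"
proof -
  note f = success_prob_eq[OF K(1) M unif]
  let ?m = "\<lambda>z. measure lebesgue (event_set K T z)" and ?k = "measure lborel K"
  have "mult_brunn_minkowski u v (event_set K T x) (event_set K T y)"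
    using K uv by (intro mult_brunn_minkowski_convex convex_event_set compact_imp_bounded compact_event_set)
  then have "?m x powr u * ?m y powr v \<le> ?m (u *\<^sub>R x + v *\<^sub>R y)"
    unfolding mult_brunn_minkowski_def
    using event_set_combination K uv lmeasurable_compact[OF compact_event_set[OF K(1)]]
    by (metis less_imp_le)
  \<comment> \<open>Normalizing by the volume of \<open>K\<close> respects the inequality, again
    because the weights sum to one.\<close>
  moreover have "?k powr u * ?k powr v = ?k"
    using f(1) uv by (simp flip: powr_add)
  then have "(?m x / ?k) powr u * (?m y / ?k) powr v = ?m x powr u * ?m y powr v / ?k"
    by (simp add: powr_divide)
  ultimately show ?thesis
    unfolding f(2) using f(1) by (simp add: divide_right_mono)
qed

section \<open>Convexity of the negative logarithm and agreement of minimizers and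
  maximizers\<close>

theorem theorem3:
  fixes M :: "'a measure"
    and \<zeta> :: "'a \<Rightarrow> real ^ 'd"
    and K :: "(real ^ 'd) set"
    and X :: "(real ^ 'n) set"
    and T :: "real ^ 'n ^ 'd"
  assumes "compact K" and "convex K" and "\<forall>z\<in>K. - z \<in> K"
    and "prob_space M"
    and "\<zeta> \<in> borel_measurable M"
    and "distr M lborel \<zeta> = uniform_measure lborel K"
    and "closed X" and "convex X" and "bounded X"
  shows "ereal_convex_on X (neg_log_prob M \<zeta> K T) \<and>
         (\<forall>x. is_arg_min (neg_log_prob M \<zeta> K T) (\<lambda>y. y \<in> X) x \<longleftrightarrow>
              is_arg_max (success_prob M \<zeta> K T) (\<lambda>y. y \<in> X) x)"
proof -
  let ?f = "success_prob M \<zeta> K T" and ?h = "neg_log_prob M \<zeta> K T"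
  have nonneg: "?f x \<ge> 0" for x by (simp add: success_prob_def)
  have not_minf: "?h x \<noteq> -\<infinity>" for x by (simp add: neg_log_prob_def)
  have conv: "?h (u *\<^sub>R x + v *\<^sub>R y) \<le> ereal u * ?h x + ereal v * ?h y"
    if uv: "u \<ge> 0" "v \<ge> 0" "u + v = 1" for u v x y
  proof -
    \<comment> \<open>Zero weights come first: there \<open>0 * \<infinity> = 0\<close> and both
      sides agree. With positive weights, an infinite value makes the right-hand side infinite; only
      the last case needs log-concavity.\<close>
    consider "u = 0" | "v = 0" | "u > 0" "v > 0" "?f x = 0 \<or> ?f y = 0"
      | "u > 0" "v > 0" "?f x > 0" "?f y > 0"
      using uv nonneg[of x] nonneg[of y] by linarith
    then show ?thesis
    proof cases
      case 1
      then show ?thesis using uv by (simp flip: zero_ereal_def one_ereal_def)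
    next
      case 2
      then show ?thesis using uv by (simp flip: zero_ereal_def one_ereal_def)
    next
      case 3
      then have "ereal u * ?h x + ereal v * ?h y = \<infinity>"
        by (auto simp: neg_log_prob_def)
      then show ?thesis by (simp only: ereal_less_eq(1))
    next
      case 4
      let ?z = "u *\<^sub>R x + v *\<^sub>R y"
      have le: "?f x powr u * ?f y powr v \<le> ?f ?z"
        using assms 4 uv by (intro success_prob_log_concave)
      have pos: "?f x powr u * ?f y powr v > 0" using 4 by simp
      \<comment> \<open>Positivity at the combined point puts \<open>?h ?z\<close> in its finite
        branch.\<close>
      with le have fz: "?f ?z > 0" by linarith
      have "ln (?f x powr u * ?f y powr v) \<le> ln (?f ?z)"
        using le pos fz by simp
      then have "u * ln (?f x) + v * ln (?f y) \<le> ln (?f ?z)"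
        using 4 by (simp add: ln_mult ln_powr)
      then show ?thesis
        using 4 fz by (simp add: neg_log_prob_def)
    qed
  qed
  \<comment> \<open>The function \<open>?h\<close> is a strictly decreasing image of
    \<open>?f\<close>, with 0 sent to \<open>\<infinity>\<close>. Since \<open>is_arg_min\<close>
    and \<open>is_arg_max\<close> are phrased through strict comparisons, this yields part (b) by
    rewriting.\<close>
  have order: "?h y < ?h x \<longleftrightarrow> ?f x < ?f y" for x y
    using nonneg[of x] nonneg[of y] by (auto simp: neg_log_prob_def)
  show ?thesis
    using \<open>convex X\<close> not_minf conv
    by (simp add: ereal_convex_on_def is_arg_min_def is_arg_max_def order)
qed

end
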